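(* Let $(X,d_X)$, $(Y,d_Y)$, $(Z,d_Z)$ be arbitrary (nonempty) bounded Lorentzian-metric spaces that all contain the spacelike boundary point $i^0$. Then: (a) $d_{GH}(X,Y)\ge 0$; moreover $d_{GH}(X,Y)=0$ if and only if $(X,d_X)$ and $(Y,d_Y)$ are isometric and homeomorphic, that is, there exists an isometry $f\colon X\to Y$ (which is then also a homeomorphism for the topologies of $X$ and $Y$). (b) $d_{GH}(X,Y)=d_{GH}(Y,X)$. (c) $d_{GH}(X,Z)\le d_{GH}(X,Y)+d_{GH}(Y,Z)$. The same result holds if instead none of the spaces contains $i^0$.
   Context: A bounded Lorentzian-metric space $(X,d)$ is a set $X$ with a map $d\colon X\times X\to[0,\infty)$ such that: (i) if $d(x,y)>0$ and $d(y,z)>0$ then $d(x,z)\ge d(x,y)+d(y,z)$; (ii) there is a topology $T$ on $X$ such that $d$ is continuous for $T\times T$ and for every $\epsilon>0$ the set $\{(p,q): d(p,q)\ge\epsilon\}$ is compact for $T\times T$; (iii) for every $x\ne y$ there is $z$ with $d(x,z)\ne d(y,z)$ or $d(z,x)\ne d(z,y)$. The topology $\mathscr{T}$ of $(X,d)$ is the intersection of all topologies $T$ as in (ii). The space contains the spacelike boundary if there is a (necessarily unique) point $i^0\in X$ with $d(i^0,p)=d(p,i^0)=0$ for all $p\in X$. An isometry $f\colon X\to Y$ is a bijection with $d_Y(f(x),f(x'))=d_X(x,x')$ for all $x,x'$. A correspondence between nonempty sets $X$ and $Y$ is a relation $R\subset X\times Y$ such that every $x\in X$ is related to some $y\in Y$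 and every $y\in Y$ is related to some $x\in X$. Its distortion is $\mathrm{dis}\,R=\sup\{|d_X(x,x')-d_Y(y,y')| : (x,y),(x',y')\in R\}$. The Gromov-Hausdorff semi-distance is $d_{GH}(X,Y)=\inf_R \mathrm{dis}\,R$, the infimum being over all correspondences $R\subset X\times Y$ (the function $d$ of a bounded Lorentzian-metric space is always bounded). *)

theory Defs
  imports "HOL-Analysis.Analysis"
begin

text \<open>
  A space is given by a carrier set \<open>X\<close> and a function \<open>d\<close> on the ambient type; the values of
  \<open>d\<close> outside \<open>X \<times> X\<close> are irrelevant.
\<close>

definition admissible_topology :: "'a set \<Rightarrow> ('a \<Rightarrow> 'a \<Rightarrow> real) \<Rightarrow> 'a topology \<Rightarrow> bool" where
  "admissible_topology X d T \<longleftrightarrow>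
     topspace T = X \<and>
     continuous_map (prod_topology T T) euclideanreal (\<lambda>(p, q). d p q) \<and>
     (\<forall>\<epsilon>>0. compactin (prod_topology T T) {(p, q). p \<in> X \<and> q \<in> X \<and> d p q \<ge> \<epsilon>})"

locale bounded_lorentzian_metric_space =
  fixes X :: "'a set" and d :: "'a \<Rightarrow> 'a \<Rightarrow> real"
  assumes nonneg: "\<lbrakk>x \<in> X; y \<in> X\<rbrakk> \<Longrightarrow> d x y \<ge> 0"
    and reverse_triangle:
      "\<lbrakk>x \<in> X; y \<in> X; z \<in> X; d x y > 0; d y z > 0\<rbrakk> \<Longrightarrow> d x z \<ge> d x y + d y z"
    and ex_admissible_topology: "\<exists>T. admissible_topology X d T"
    and distinguishing:
      "\<lbrakk>x \<in> X; y \<in> X; x \<noteq> y\<rbrakk> \<Longrightarrow> \<exists>z\<in>X. d x z \<noteq> d y z \<or> d z x \<noteq> d z y"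

definition lorentzian_topology :: "'a set \<Rightarrow> ('a \<Rightarrow> 'a \<Rightarrow> real) \<Rightarrow> 'a topology" where
  "lorentzian_topology X d =
     topology (\<lambda>U. U \<subseteq> X \<and> (\<forall>T. admissible_topology X d T \<longrightarrow> openin T U))"

lemma openin_lorentzian_topology:
  "openin (lorentzian_topology X d) U \<longleftrightarrow>
     U \<subseteq> X \<and> (\<forall>T. admissible_topology X d T \<longrightarrow> openin T U)"
proof -
  have "istopology (\<lambda>U. U \<subseteq> X \<and> (\<forall>T. admissible_topology X d T \<longrightarrow> openin T U))"
    unfolding istopology_def by (blast intro: openin_Int openin_Union)
  then show ?thesis
    by (simp add: lorentzian_topology_def topology_inverse')
qed

definition contains_spacelike_boundary :: "'a set \<Rightarrow> ('a \<Rightarrow> 'a \<Rightarrow> real) \<Rightarrow> bool" where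
  "contains_spacelike_boundary X d \<longleftrightarrow> (\<exists>i\<in>X. \<forall>p\<in>X. d i p = 0 \<and> d p i = 0)"

definition lorentzian_isometry ::
    "'a set \<Rightarrow> ('a \<Rightarrow> 'a \<Rightarrow> real) \<Rightarrow> 'b set \<Rightarrow> ('b \<Rightarrow> 'b \<Rightarrow> real) \<Rightarrow> ('a \<Rightarrow> 'b) \<Rightarrow> bool" where
  "lorentzian_isometry X dX Y dY f \<longleftrightarrow>
     bij_betw f X Y \<and> (\<forall>x\<in>X. \<forall>x'\<in>X. dY (f x) (f x') = dX x x')"

definition correspondence :: "'a set \<Rightarrow> 'b set \<Rightarrow> ('a \<times> 'b) set \<Rightarrow> bool" where
  "correspondence X Y R \<longleftrightarrow>
     R \<subseteq> X \<times> Y \<and> (\<forall>x\<in>X. \<exists>y\<in>Y. (x, y) \<in> R) \<and> (\<forall>y\<in>Y. \<exists>x\<in>X. (x, y) \<in> R)"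

text \<open>
  The supremum and the infimum below are taken in the conditionally complete type \<open>real\<close>. For
  nonempty bounded Lorentzian-metric spaces they range over nonempty sets that are bounded above
  and below, respectively: \<open>d\<close> is continuous, hence bounded, on the compact set where
  it is at least \<open>1\<close>.
\<close>

definition distortion ::
    "('a \<Rightarrow> 'a \<Rightarrow> real) \<Rightarrow> ('b \<Rightarrow> 'b \<Rightarrow> real) \<Rightarrow> ('a \<times> 'b) set \<Rightarrow> real" where
  "distortion dX dY R =
     Sup {\<bar>dX x x' - dY y y'\<bar> | x y x' y'. (x, y) \<in> R \<and> (x', y') \<in> R}"

definition gromov_hausdorff_semidist ::
    "'a set \<Rightarrow> ('a \<Rightarrow> 'a \<Rightarrow> real) \<Rightarrow> 'b set \<Rightarrow> ('b \<Rightarrow> 'b \<Rightarrow> real) \<Rightarrow> real" where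
  "gromov_hausdorff_semidist X dX Y dY = Inf {distortion dX dY R | R. correspondence X Y R}"

end

theory Submission
  imports Defs
begin

text \<open>
  Everything except the vanishing criterion is formal: correspondences can be reversed and
  composed, the distortion of a composition is at most the sum of the distortions, and an isometry
  is a correspondence of distortion zero that carries the admissible topologies of one space onto
  those of the other. The suprema and infima behave as expected because \<open>d\<close> is bounded
  (\<open>distortion_le_iff\<close>).

  The substance is that vanishing semi-distance yields an isometry. Let \<open>R n\<close> be correspondences
  whose distortions tend to zero. For each \<open>x \<in> X\<close> pick \<open>u x n \<in> Y\<close>, related to \<open>x\<close>
  by \<open>R n\<close> for large \<open>n\<close>, and for each \<open>y \<in> Y\<close> pick \<open>v y n \<in> X\<close> likewise. If \<open>d x z > 0\<close> or
  \<open>d z x > 0\<close> for some \<open>z\<close>, then \<open>u x n\<close> can be chosen in a projection of a set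
  \<open>{(p, q). d p q \<ge> \<epsilon>}\<close>, which is compact; if there is no such \<open>z\<close>, then \<open>x\<close> is the
  spacelike boundary, and since both spaces or neither have one, it may be matched with
  the spacelike boundary of the other space at no cost in distortion
  (\<open>correspondence_Un_boundary_points\<close>, \<open>eventually_partner_in_compact\<close>). So the pairs of sequences
  \<open>(u, v)\<close> live in a product of compact spaces, and by Tychonoff's theorem they have a cluster
  point \<open>(f, g)\<close>.

  Taking \<open>f\<close> and \<open>g\<close> from a single cluster point is what makes them compatible: besides
  \<open>dY (f x) (f x') = dX x x'\<close> and \<open>dX (g y) (g y') = dY y y'\<close>, also \<open>dY (f x) y = dX x (g y)\<close>
  passes to the limit, and likewise with the arguments exchanged. Hence \<open>f (g y)\<close> and \<open>y\<close> have
  the same \<open>d\<close> to and from every point, so they are equal because points are distinguished by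
  \<open>d\<close>; symmetrically \<open>g (f x) = x\<close>. Thus \<open>f\<close> is a bijection.
\<close>

section \<open>Correspondences and distortion\<close>

definition distortion_at_most ::
    "('a \<Rightarrow> 'a \<Rightarrow> real) \<Rightarrow> ('b \<Rightarrow> 'b \<Rightarrow> real) \<Rightarrow> ('a \<times> 'b) set \<Rightarrow> real \<Rightarrow> bool" where
  "distortion_at_most dX dY R e \<longleftrightarrow>
     (\<forall>x y x' y'. (x, y) \<in> R \<longrightarrow> (x', y') \<in> R \<longrightarrow> \<bar>dX x x' - dY y y'\<bar> \<le> e)"

lemma distortion_at_mostD:
  "\<lbrakk>distortion_at_most dX dY R e; (x, y) \<in> R; (x', y') \<in> R\<rbrakk> \<Longrightarrow> \<bar>dX x x' - dY y y'\<bar> \<le> e"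
  unfolding distortion_at_most_def by blast

lemma correspondence_converse: "correspondence X Y R \<Longrightarrow> correspondence Y X (R\<inverse>)"
  unfolding correspondence_def by blast

lemma correspondence_relcomp:
  assumes "correspondence X Y R" and "correspondence Y Z S"
  shows "correspondence X Z (R O S)"
  using assms unfolding correspondence_def by (intro conjI ballI) blast+

lemma distortion_at_most_converse:
  "distortion_at_most dX dY R e \<Longrightarrow> distortion_at_most dY dX (R\<inverse>) e"
  unfolding distortion_at_most_def by (auto simp: abs_minus_commute)

lemma distortion_at_most_relcomp:
  assumes R: "distortion_at_most dX dY R a" and S: "distortion_at_most dY dZ S b"
  shows "distortion_at_most dX dZ (R O S) (a + b)"
  unfolding distortion_at_most_def
proof (intro allI impI)
  fix x z x' z' assume "(x, z) \<in> R O S" and "(x', z') \<in> R O S"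
  then obtain y y' where "(x, y) \<in> R" "(y, z) \<in> S" "(x', y') \<in> R" "(y', z') \<in> S"
    by blast
  then have "\<bar>dX x x' - dY y y'\<bar> \<le> a" and "\<bar>dY y y' - dZ z z'\<bar> \<le> b"
    using distortion_at_mostD R S by fast+
  then show "\<bar>dX x x' - dZ z z'\<bar> \<le> a + b"
    by linarith
qed

text \<open>
  The function is continuous on the compact set where it is at least \<open>1\<close>, and less than \<open>1\<close>
  elsewhere.
\<close>

lemma (in bounded_lorentzian_metric_space) bounded_above:
  obtains B where "\<And>x y. \<lbrakk>x \<in> X; y \<in> X\<rbrakk> \<Longrightarrow> d x y \<le> B"
proof -
  obtain T where T: "admissible_topology X d T"
    using ex_admissible_topology by blast
  let ?K = "{(p, q). p \<in> X \<and> q \<in> X \<and> d p q \<ge> 1}"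
  have "compactin (prod_topology T T) ?K"
    and "continuous_map (prod_topology T T) euclideanreal (\<lambda>(p, q). d p q)"
    using T unfolding admissible_topology_def by auto
  then have "compact ((\<lambda>(p, q). d p q) ` ?K)"
    using image_compactin by fastforce
  then have "bdd_above ((\<lambda>(p, q). d p q) ` ?K)"
    by (intro bounded_imp_bdd_above compact_imp_bounded)
  then obtain B where "\<And>x y. \<lbrakk>x \<in> X; y \<in> X; d x y \<ge> 1\<rbrakk> \<Longrightarrow> d x y \<le> B"
    by (auto simp: bdd_above_def)
  then have "d x y \<le> max B 1" if "x \<in> X" "y \<in> X" for x y
    using that by (cases "d x y \<ge> 1") (auto simp: le_max_iff_disj)
  then show thesis
    using that by blast
qed

lemma distortion_le_iff:
  assumes LX: "bounded_lorentzian_metric_space X dX" and "X \<noteq> {}"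
    and LY: "bounded_lorentzian_metric_space Y dY" and R: "correspondence X Y R"
  shows "distortion dX dY R \<le> e \<longleftrightarrow> distortion_at_most dX dY R e"
proof -
  interpret X: bounded_lorentzian_metric_space X dX by (fact LX)
  interpret Y: bounded_lorentzian_metric_space Y dY by (fact LY)
  let ?D = "{\<bar>dX x x' - dY y y'\<bar> | x y x' y'. (x, y) \<in> R \<and> (x', y') \<in> R}"
  obtain A where A: "\<And>x y. \<lbrakk>x \<in> X; y \<in> X\<rbrakk> \<Longrightarrow> dX x y \<le> A"
    using X.bounded_above by blast
  obtain B where B: "\<And>x y. \<lbrakk>x \<in> Y; y \<in> Y\<rbrakk> \<Longrightarrow> dY x y \<le> B"
    using Y.bounded_above by blast
  have "?D \<noteq> {}"
    using R \<open>X \<noteq> {}\<close> unfolding correspondence_def by blast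
  moreover have "bdd_above ?D"
  proof (rule bdd_aboveI)
    fix t assume "t \<in> ?D"
    then obtain x y x' y' where "t = \<bar>dX x x' - dY y y'\<bar>" "(x, y) \<in> R" "(x', y') \<in> R"
      by blast
    moreover from this have "x \<in> X" "x' \<in> X" "y \<in> Y" "y' \<in> Y"
      using R unfolding correspondence_def by auto
    ultimately show "t \<le> max A B"
      using A[of x x'] B[of y y'] X.nonneg[of x x'] Y.nonneg[of y y'] by linarith
  qed
  ultimately have "distortion dX dY R \<le> e \<longleftrightarrow> (\<forall>t\<in>?D. t \<le> e)"
    unfolding distortion_def by (rule cSup_le_iff)
  then show ?thesis
    unfolding distortion_at_most_def by blast
qed

lemma distortion_at_most_nonneg:
  assumes "X \<noteq> {}" and "correspondence X Y R" and "distortion_at_most dX dY R e"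
  shows "e \<ge> 0"
proof -
  obtain x y where "(x, y) \<in> R"
    using assms unfolding correspondence_def by blast
  then have "\<bar>dX x x - dY y y\<bar> \<le> e"
    using distortion_at_mostD assms(3) by fast
  then show ?thesis by linarith
qed

section \<open>The semi-distance\<close>

lemma gromov_hausdorff_semidist_le:
  assumes "bounded_lorentzian_metric_space X dX" and "X \<noteq> {}"
    and "bounded_lorentzian_metric_space Y dY"
    and "correspondence X Y R" and "distortion_at_most dX dY R e"
  shows "gromov_hausdorff_semidist X dX Y dY \<le> e"
proof -
  have "bdd_below {distortion dX dY R | R. correspondence X Y R}"
    using distortion_at_most_nonneg[OF \<open>X \<noteq> {}\<close>] distortion_le_iff[OF assms(1-3)]
    by (intro bdd_belowI[where m = 0]) blast
  then have "gromov_hausdorff_semidist X dX Y dY \<le> distortion dX dY R"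
    unfolding gromov_hausdorff_semidist_def using assms(4) by (intro cInf_lower) blast+
  also have "\<dots> \<le> e"
    using distortion_le_iff[OF assms(1-4)] assms(5) by blast
  finally show ?thesis .
qed

lemma gromov_hausdorff_semidist_less:
  assumes "bounded_lorentzian_metric_space X dX" and "X \<noteq> {}"
    and "bounded_lorentzian_metric_space Y dY" and "Y \<noteq> {}"
    and "gromov_hausdorff_semidist X dX Y dY < e"
  obtains R where "correspondence X Y R" and "distortion_at_most dX dY R e"
proof -
  have "correspondence X Y (X \<times> Y)"
    using assms unfolding correspondence_def by blast
  then have "{distortion dX dY R | R. correspondence X Y R} \<noteq> {}"
    by blast
  then have "\<exists>t\<in>{distortion dX dY R | R. correspondence X Y R}. t < e"
    using assms(5) unfolding gromov_hausdorff_semidist_def by (rule cInf_lessD)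
  then obtain R where "correspondence X Y R" and "distortion dX dY R < e"
    by blast
  then show thesis
    using that distortion_le_iff[OF assms(1-3)] less_imp_le by metis
qed

lemma gromov_hausdorff_semidist_nonneg:
  assumes "bounded_lorentzian_metric_space X dX" and "X \<noteq> {}"
    and "bounded_lorentzian_metric_space Y dY" and "Y \<noteq> {}"
  shows "gromov_hausdorff_semidist X dX Y dY \<ge> 0"
proof (rule dense_ge)
  fix e assume "gromov_hausdorff_semidist X dX Y dY < e"
  then obtain R where "correspondence X Y R" and "distortion_at_most dX dY R e"
    using gromov_hausdorff_semidist_less assms by blast
  then show "0 \<le> e"
    using distortion_at_most_nonneg[OF \<open>X \<noteq> {}\<close>] by blast
qed

lemma gromov_hausdorff_semidist_sym_le:
  assumes "bounded_lorentzian_metric_space X dX" and "X \<noteq> {}"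
    and "bounded_lorentzian_metric_space Y dY" and "Y \<noteq> {}"
  shows "gromov_hausdorff_semidist X dX Y dY \<le> gromov_hausdorff_semidist Y dY X dX"
proof (rule dense_ge)
  fix e assume "gromov_hausdorff_semidist Y dY X dX < e"
  then obtain R where "correspondence Y X R" and "distortion_at_most dY dX R e"
    using gromov_hausdorff_semidist_less assms by blast
  then show "gromov_hausdorff_semidist X dX Y dY \<le> e"
    using gromov_hausdorff_semidist_le[OF assms(1-3)] correspondence_converse
      distortion_at_most_converse by blast
qed

lemma gromov_hausdorff_semidist_triangle:
  assumes "bounded_lorentzian_metric_space X dX" and "X \<noteq> {}"
    and "bounded_lorentzian_metric_space Y dY" and "Y \<noteq> {}"
    and "bounded_lorentzian_metric_space Z dZ" and "Z \<noteq> {}"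
  shows "gromov_hausdorff_semidist X dX Z dZ \<le>
           gromov_hausdorff_semidist X dX Y dY + gromov_hausdorff_semidist Y dY Z dZ"
proof (rule field_le_epsilon)
  fix e :: real assume "e > 0"
  let ?a = "gromov_hausdorff_semidist X dX Y dY" and ?b = "gromov_hausdorff_semidist Y dY Z dZ"
  obtain R where R: "correspondence X Y R" "distortion_at_most dX dY R (?a + e / 2)"
    using gromov_hausdorff_semidist_less[OF assms(1-4), of "?a + e / 2"] \<open>e > 0\<close> by auto
  obtain S where S: "correspondence Y Z S" "distortion_at_most dY dZ S (?b + e / 2)"
    using gromov_hausdorff_semidist_less[OF assms(3-6), of "?b + e / 2"] \<open>e > 0\<close> by auto
  have "gromov_hausdorff_semidist X dX Z dZ \<le> (?a + e / 2) + (?b + e / 2)"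
    using R S correspondence_relcomp distortion_at_most_relcomp
    by (intro gromov_hausdorff_semidist_le[where R = "R O S"] assms) blast+
  then show "gromov_hausdorff_semidist X dX Z dZ \<le> ?a + ?b + e"
    by simp
qed

section \<open>Isometries\<close>

lemma lorentzian_isometry_inv:
  assumes "lorentzian_isometry X dX Y dY f"
  shows "lorentzian_isometry Y dY X dX (inv_into X f)"
  unfolding lorentzian_isometry_def
proof (intro conjI ballI)
  have bij: "bij_betw f X Y"
    using assms unfolding lorentzian_isometry_def by blast
  then show inv: "bij_betw (inv_into X f) Y X"
    by (rule bij_betw_inv_into)
  fix y y' assume y: "y \<in> Y" "y' \<in> Y"
  then have "dY (f (inv_into X f y)) (f (inv_into X f y'))
      = dX (inv_into X f y) (inv_into X f y')"
    using assms bij_betw_apply[OF inv] unfolding lorentzian_isometry_def by blast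
  then show "dX (inv_into X f y) (inv_into X f y') = dY y y'"
    using y by (simp add: bij_betw_inv_into_right[OF bij])
qed

text \<open>
  Transport of structure: the topology induced on \<open>Y\<close> by the inverse of \<open>f\<close> makes \<open>f\<close> a
  homeomorphism.
\<close>

lemma admissible_topology_transport:
  assumes f: "lorentzian_isometry X dX Y dY f" and T: "admissible_topology X dX T"
  obtains T' where "admissible_topology Y dY T'" and "continuous_map T T' f"
proof -
  define g where "g = inv_into X f"
  define T' where "T' = pullback_topology Y g T"
  have bij: "bij_betw f X Y" and dist: "\<And>x x'. \<lbrakk>x \<in> X; x' \<in> X\<rbrakk> \<Longrightarrow> dY (f x) (f x') = dX x x'"
    using f unfolding lorentzian_isometry_def by auto
  have topT: "topspace T = X"
    using T unfolding admissible_topology_def by blast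
  have gX: "g y \<in> X" and fg: "f (g y) = y" if "y \<in> Y" for y
    using bij that unfolding g_def
    by (auto simp: bij_betw_inv_into_right bij_betw_def inv_into_into)
  have gf: "g (f x) = x" and fY: "f x \<in> Y" if "x \<in> X" for x
    using bij that unfolding g_def by (auto simp: bij_betw_inv_into_left bij_betw_apply)
  have topT': "topspace T' = Y"
    using gX by (auto simp: T'_def topspace_pullback_topology topT)
  have contf: "continuous_map T T' f"
    unfolding T'_def
  proof (rule continuous_map_pullback')
    show "continuous_map T T (g \<circ> f)"
      by (rule continuous_map_eq[OF continuous_map_id]) (simp add: topT gf)
    show "topspace T \<subseteq> f -` Y"
      using fY topT by auto
  qed
  have contg: "continuous_map T' T g"
    using continuous_map_pullback[OF continuous_map_id, of Y g T] by (simp add: T'_def)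
  have "continuous_map (prod_topology T' T') euclideanreal
      ((\<lambda>(p, q). dX p q) \<circ> (\<lambda>(p, q). (g p, g q)))"
    using T contg unfolding admissible_topology_def
    by (intro continuous_map_compose) (auto simp: continuous_map_prod_top)
  then have contd: "continuous_map (prod_topology T' T') euclideanreal (\<lambda>(p, q). dY p q)"
    by (rule continuous_map_eq) (use dist gX fg topT' in \<open>force simp: fg\<close>)
  have "compactin (prod_topology T' T') {(p, q). p \<in> Y \<and> q \<in> Y \<and> dY p q \<ge> e}" if "e > 0" for e
  proof -
    have "{(p, q). p \<in> Y \<and> q \<in> Y \<and> dY p q \<ge> e}
        = (\<lambda>(p, q). (f p, f q)) ` {(p, q). p \<in> X \<and> q \<in> X \<and> dX p q \<ge> e}"
      (is "?K = ?h ` ?L")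
    proof
      show "?K \<subseteq> ?h ` ?L"
      proof clarify
        fix p q assume "p \<in> Y" "q \<in> Y" "dY p q \<ge> e"
        then show "(p, q) \<in> ?h ` ?L"
          using gX fg dist[of "g p" "g q"] by (intro image_eqI[of _ _ "(g p, g q)"]) auto
      qed
      show "?h ` ?L \<subseteq> ?K"
        using fY dist by auto
    qed
    moreover have "compactin (prod_topology T' T') (?h ` ?L)"
      by (rule image_compactin[of "prod_topology T T"])
        (use T that contf in \<open>auto simp: admissible_topology_def continuous_map_prod_top\<close>)
    ultimately show ?thesis by simp
  qed
  then have "admissible_topology Y dY T'"
    unfolding admissible_topology_def using topT' contd by blast
  then show thesis
    using that contf by blast
qed

lemma topspace_lorentzian_topology [simp]: "topspace (lorentzian_topology X d) = X"
proof
  show "topspace (lorentzian_topology X d) \<subseteq> X"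
    using openin_topspace openin_lorentzian_topology by metis
  have "openin (lorentzian_topology X d) X"
    unfolding openin_lorentzian_topology admissible_topology_def by auto
  then show "X \<subseteq> topspace (lorentzian_topology X d)"
    by (rule openin_subset)
qed

lemma continuous_map_lorentzian_isometry:
  assumes f: "lorentzian_isometry X dX Y dY f"
  shows "continuous_map (lorentzian_topology X dX) (lorentzian_topology Y dY) f"
  unfolding continuous_map_def
proof (intro conjI allI impI)
  show "f \<in> topspace (lorentzian_topology X dX) \<rightarrow> topspace (lorentzian_topology Y dY)"
    using f unfolding lorentzian_isometry_def by (auto dest: bij_betw_apply)
  fix U assume U: "openin (lorentzian_topology Y dY) U"
  have "openin T {x \<in> X. f x \<in> U}" if T: "admissible_topology X dX T" for T
  proof -
    obtain T' where T': "admissible_topology Y dY T'" and "continuous_map T T' f"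
      using admissible_topology_transport[OF f T] by blast
    moreover have "openin T' U"
      using U T' unfolding openin_lorentzian_topology by blast
    moreover have "topspace T = X"
      using T unfolding admissible_topology_def by blast
    ultimately show ?thesis
      unfolding continuous_map_def by auto
  qed
  then show "openin (lorentzian_topology X dX)
      {x \<in> topspace (lorentzian_topology X dX). f x \<in> U}"
    by (auto simp: openin_lorentzian_topology)
qed

lemma homeomorphic_map_lorentzian_isometry:
  assumes f: "lorentzian_isometry X dX Y dY f"
  shows "homeomorphic_map (lorentzian_topology X dX) (lorentzian_topology Y dY) f"
proof -
  have "bij_betw f X Y"
    using f unfolding lorentzian_isometry_def by blast
  then have "homeomorphic_maps (lorentzian_topology X dX) (lorentzian_topology Y dY)
      f (inv_into X f)"
    unfolding homeomorphic_maps_def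
    using continuous_map_lorentzian_isometry[OF f]
      continuous_map_lorentzian_isometry[OF lorentzian_isometry_inv[OF f]]
    by (auto simp: bij_betw_inv_into_left bij_betw_inv_into_right)
  then show ?thesis
    by (rule homeomorphic_maps_imp_map)
qed

lemma lorentzian_isometry_imp_semidist_zero:
  assumes "bounded_lorentzian_metric_space X dX" and "X \<noteq> {}"
    and "bounded_lorentzian_metric_space Y dY" and "Y \<noteq> {}"
    and f: "lorentzian_isometry X dX Y dY f"
  shows "gromov_hausdorff_semidist X dX Y dY = 0"
proof (rule antisym)
  let ?R = "{(x, f x) | x. x \<in> X}"
  have "correspondence X Y ?R"
    using f unfolding correspondence_def lorentzian_isometry_def bij_betw_def by blast
  moreover have "distortion_at_most dX dY ?R 0"
    using f unfolding distortion_at_most_def lorentzian_isometry_def by auto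
  ultimately show "gromov_hausdorff_semidist X dX Y dY \<le> 0"
    using gromov_hausdorff_semidist_le assms by blast
qed (rule gromov_hausdorff_semidist_nonneg[OF assms(1-4)])

section \<open>Isometries as limits of correspondences\<close>

text \<open>
  A cluster point of the sequence. It need not be the limit of a subsequence, since the space
  to which this is applied is a possibly uncountable product; knowing it through continuous functions is enough.
\<close>

lemma compact_space_cluster_point:
  fixes s :: "nat \<Rightarrow> 'a"
  assumes P: "compact_space P" and s: "\<And>n. s n \<in> topspace P"
  shows "\<exists>p\<in>topspace P. \<forall>h c. continuous_map P euclideanreal h \<longrightarrow>
           (\<lambda>n. h (s n)) \<longlonglongrightarrow> c \<longrightarrow> h p = c"
proof -
  define C where "C n = P closure_of (s ` {n..})" for n
  have "s n \<in> C n" for n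
    unfolding C_def using s by (intro subsetD[OF closure_of_subset]) auto
  then have "(\<Inter>n. C n) \<noteq> {}"
    by (intro compact_space_imp_nest[OF P])
      (auto simp: C_def decseq_def intro!: closure_of_mono)
  then obtain p where p: "\<And>n. p \<in> C n"
    by blast
  have "h p = c" if h: "continuous_map P euclideanreal h" and lim: "(\<lambda>n. h (s n)) \<longlonglongrightarrow> c" for h c
  proof -
    have "\<bar>h p - c\<bar> \<le> e" if "e > 0" for e
    proof -
      have "closedin P {x \<in> topspace P. h x \<in> cball c e}"
        using h by (rule closedin_continuous_map_preimage) simp
      moreover obtain N where "\<And>n. n \<ge> N \<Longrightarrow> dist (h (s n)) c < e"
        using lim \<open>e > 0\<close> unfolding lim_sequentially by blast
      then have "s ` {N..} \<subseteq> {x \<in> topspace P. h x \<in> cball c e}"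
        using s by (force simp: dist_commute)
      ultimately have "C N \<subseteq> {x \<in> topspace P. h x \<in> cball c e}"
        unfolding C_def by (rule closure_of_minimal[rotated])
      then show ?thesis
        using p[of N] by (auto simp: dist_real_def)
    qed
    then have "\<bar>h p - c\<bar> \<le> 0"
      by (rule dense_ge)
    then show ?thesis by simp
  qed
  moreover have "p \<in> topspace P"
    using p[of 0] closure_of_subset_topspace unfolding C_def by fast
  ultimately show ?thesis
    by blast
qed

definition spacelike_boundary_point :: "'a set \<Rightarrow> ('a \<Rightarrow> 'a \<Rightarrow> real) \<Rightarrow> 'a \<Rightarrow> bool" where
  "spacelike_boundary_point X d i \<longleftrightarrow> i \<in> X \<and> (\<forall>p\<in>X. d i p = 0 \<and> d p i = 0)"

text \<open>
  Pairs of boundary points may be added freely: an added pair only ever contributes \<open>\<bar>0 - 0\<bar>\<close>,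
  whatever it is compared with.
\<close>

lemma correspondence_Un_boundary_points:
  assumes R: "correspondence X Y R" and dis: "distortion_at_most dX dY R e" and "X \<noteq> {}"
  defines "S \<equiv> {(i, j). spacelike_boundary_point X dX i \<and> spacelike_boundary_point Y dY j}"
  shows "correspondence X Y (R \<union> S)" and "distortion_at_most dX dY (R \<union> S) e"
proof -
  show "correspondence X Y (R \<union> S)"
    using R unfolding correspondence_def S_def spacelike_boundary_point_def by auto
  have sub: "R \<subseteq> X \<times> Y"
    using R unfolding correspondence_def by blast
  have "e \<ge> 0"
    using distortion_at_most_nonneg[OF \<open>X \<noteq> {}\<close> R dis] .
  show "distortion_at_most dX dY (R \<union> S) e"
    unfolding distortion_at_most_def
  proof (intro allI impI)
    fix x y x' y' assume xy: "(x, y) \<in> R \<union> S" "(x', y') \<in> R \<union> S"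
    show "\<bar>dX x x' - dY y y'\<bar> \<le> e"
    proof (cases "(x, y) \<in> R \<and> (x', y') \<in> R")
      case True
      then show ?thesis
        using distortion_at_mostD[OF dis] by blast
    next
      case False
      have "x \<in> X" "y \<in> Y" "x' \<in> X" "y' \<in> Y"
        using xy sub unfolding S_def spacelike_boundary_point_def by auto
      then have "dX x x' = 0" "dY y y' = 0"
        using False xy unfolding S_def spacelike_boundary_point_def by auto
      then show ?thesis
        using \<open>e \<ge> 0\<close> by simp
    qed
  qed
qed

text \<open>
  This keeps the limit from escaping. If, say, \<open>dX x z = \<delta> > 0\<close>, then partners \<open>y\<close>, \<open>w\<close> of \<open>x\<close>,
  \<open>z\<close> satisfy \<open>dY y w \<ge> \<delta> / 2\<close> as soon as the distortion is at most \<open>\<delta> / 2\<close>, so \<open>y\<close> lies in a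
  projection of a compact set.
\<close>

lemma eventually_partner_in_compact:
  assumes LX: "bounded_lorentzian_metric_space X dX" and T: "admissible_topology Y dY T"
    and R: "\<And>n. correspondence X Y (R n)"
    and dis: "\<And>n. distortion_at_most dX dY (R n) (e n)" and e: "e \<longlonglongrightarrow> 0"
    and bdry: "spacelike_boundary_point X dX x \<Longrightarrow> \<exists>j\<in>Y. \<forall>n. (x, j) \<in> R n"
    and x: "x \<in> X"
  obtains C u where "compactin T C" and "\<And>n. u n \<in> C"
    and "\<forall>\<^sub>F n in sequentially. (x, u n) \<in> R n"
proof -
  have topT: "topspace T = Y"
    using T unfolding admissible_topology_def by blast
  have "\<exists>C. compactin T C \<and> (\<forall>\<^sub>F n in sequentially. \<exists>y\<in>C. (x, y) \<in> R n)"
  proof (cases "spacelike_boundary_point X dX x")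
    case True
    then obtain j where "j \<in> Y" "\<forall>n. (x, j) \<in> R n"
      using bdry by blast
    then show ?thesis
      by (intro exI[of _ "{j}"]) (simp add: topT)
  next
    case False
    then obtain z where z: "z \<in> X" and "dX x z \<noteq> 0 \<or> dX z x \<noteq> 0"
      using x unfolding spacelike_boundary_point_def by blast
    then have pos: "dX x z > 0 \<or> dX z x > 0"
      using bounded_lorentzian_metric_space.nonneg[OF LX] x z by (metis order_le_less)
    define \<delta> where "\<delta> = max (dX x z) (dX z x)"
    have "\<delta> > 0"
      using pos by (auto simp: \<delta>_def)
    let ?K = "{(p, q). p \<in> Y \<and> q \<in> Y \<and> dY p q \<ge> \<delta> / 2}"
    have "compactin (prod_topology T T) ?K"
      using T half_gt_zero[OF \<open>\<delta> > 0\<close>] unfolding admissible_topology_def by blast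
    then have "compactin T (fst ` ?K \<union> snd ` ?K)"
      by (intro compactin_Un image_compactin[OF _ continuous_map_fst]
          image_compactin[OF _ continuous_map_snd])
    moreover have "\<forall>\<^sub>F n in sequentially. e n < \<delta> / 2"
      using order_tendstoD(2)[OF e half_gt_zero[OF \<open>\<delta> > 0\<close>]] .
    then have "\<forall>\<^sub>F n in sequentially. \<exists>y\<in>fst ` ?K \<union> snd ` ?K. (x, y) \<in> R n"
    proof eventually_elim
      case (elim n)
      obtain y w where yw: "y \<in> Y" "w \<in> Y" "(x, y) \<in> R n" "(z, w) \<in> R n"
        using R[of n] x z unfolding correspondence_def by blast
      have "\<bar>dX x z - dY y w\<bar> \<le> e n" "\<bar>dX z x - dY w y\<bar> \<le> e n"
        using distortion_at_mostD[OF dis[of n]] yw by auto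
      then have "dY y w \<ge> \<delta> / 2 \<or> dY w y \<ge> \<delta> / 2"
        using elim unfolding \<delta>_def by linarith
      then show ?case
        using yw by force
    qed
    ultimately show ?thesis by blast
  qed
  then obtain C where C: "compactin T C" and ev: "\<forall>\<^sub>F n in sequentially. \<exists>y\<in>C. (x, y) \<in> R n"
    by blast
  then obtain n where "\<exists>y\<in>C. (x, y) \<in> R n"
    unfolding eventually_sequentially by blast
  then obtain c where "c \<in> C"
    by blast
  \<comment> \<open>The finitely many early terms, where \<open>C\<close> may contain no partner of \<open>x\<close>, are set to \<open>c\<close>.\<close>
  define u where "u n = (if \<exists>y\<in>C. (x, y) \<in> R n then SOME y. y \<in> C \<and> (x, y) \<in> R n else c)" for n
  have u: "u n \<in> C \<and> (x, u n) \<in> R n" if "\<exists>y\<in>C. (x, y) \<in> R n" for n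
    using that someI_ex[of "\<lambda>y. y \<in> C \<and> (x, y) \<in> R n"] by (auto simp: u_def)
  then have "u n \<in> C" for n
    using \<open>c \<in> C\<close> by (cases "\<exists>y\<in>C. (x, y) \<in> R n") (auto simp: u_def)
  moreover have "\<forall>\<^sub>F n in sequentially. (x, u n) \<in> R n"
    using ev by eventually_elim (use u in blast)
  ultimately show thesis
    using that C by blast
qed

lemma distortion_tendsto_zero:
  assumes dis: "\<And>n. distortion_at_most dX dY (R n) (e n)" and e: "e \<longlonglongrightarrow> 0"
    and "\<forall>\<^sub>F n in sequentially. (a n, b n) \<in> R n" and "\<forall>\<^sub>F n in sequentially. (a' n, b' n) \<in> R n"
  shows "(\<lambda>n. dX (a n) (a' n) - dY (b n) (b' n)) \<longlonglongrightarrow> 0"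
proof (rule Lim_null_comparison[OF _ e])
  show "\<forall>\<^sub>F n in sequentially. norm (dX (a n) (a' n) - dY (b n) (b' n)) \<le> e n"
    using assms(3,4) by eventually_elim (use distortion_at_mostD[OF dis] in auto)
qed

lemma continuous_map_admissible:
  assumes "admissible_topology X d T" and "continuous_map P T a" and "continuous_map P T b"
  shows "continuous_map P euclideanreal (\<lambda>p. d (a p) (b p))"
proof -
  have "continuous_map P euclideanreal ((\<lambda>(p, q). d p q) \<circ> (\<lambda>p. (a p, b p)))"
    using assms unfolding admissible_topology_def
    by (intro continuous_map_compose[of P "prod_topology T T"]) (auto intro: continuous_map_pairedI)
  then show ?thesis by (simp add: o_def)
qed

text \<open>
  Surjectivity comes from the mixed identities: \<open>dY (f (g y)) w = dX (g y) (g w) = dY y w\<close> for all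
  \<open>w\<close>, and likewise with the arguments exchanged, so \<open>f (g y) = y\<close>.
\<close>

lemma lorentzian_isometry_from_adjoint_maps:
  assumes LX: "bounded_lorentzian_metric_space X dX" and LY: "bounded_lorentzian_metric_space Y dY"
    and f: "\<And>x. x \<in> X \<Longrightarrow> f x \<in> Y" and g: "\<And>y. y \<in> Y \<Longrightarrow> g y \<in> X"
    and ff: "\<And>x x'. \<lbrakk>x \<in> X; x' \<in> X\<rbrakk> \<Longrightarrow> dX x x' = dY (f x) (f x')"
    and gg: "\<And>y y'. \<lbrakk>y \<in> Y; y' \<in> Y\<rbrakk> \<Longrightarrow> dX (g y) (g y') = dY y y'"
    and fg: "\<And>x y. \<lbrakk>x \<in> X; y \<in> Y\<rbrakk> \<Longrightarrow> dX x (g y) = dY (f x) y"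
    and gf: "\<And>x y. \<lbrakk>x \<in> X; y \<in> Y\<rbrakk> \<Longrightarrow> dX (g y) x = dY y (f x)"
  shows "lorentzian_isometry X dX Y dY f"
proof -
  have "f (g y) = y" if "y \<in> Y" for y
    using bounded_lorentzian_metric_space.distinguishing[OF LY, of "f (g y)" y]
      f g fg gf gg that by metis
  moreover have "g (f x) = x" if "x \<in> X" for x
    using bounded_lorentzian_metric_space.distinguishing[OF LX, of "g (f x)" x]
      f g fg gf ff that by metis
  ultimately have "bij_betw f X Y"
    using f g by (intro bij_betw_byWitness[where f' = g]) auto
  then show ?thesis
    unfolding lorentzian_isometry_def using ff by simp
qed

text \<open>
  The boundary hypotheses supply a fixed partner for exactly those points to which the compactness
  of \<open>{(p, q). d p q \<ge> \<epsilon>}\<close> says nothing.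
\<close>

lemma lorentzian_isometry_from_small_distortion:
  fixes X :: "'a set" and Y :: "'b set"
  assumes LX: "bounded_lorentzian_metric_space X dX" and LY: "bounded_lorentzian_metric_space Y dY"
    and R: "\<And>n. correspondence X Y (R n)"
    and dis: "\<And>n. distortion_at_most dX dY (R n) (e n)" and e: "e \<longlonglongrightarrow> 0"
    and bdryX: "\<And>i. spacelike_boundary_point X dX i \<Longrightarrow> \<exists>j\<in>Y. \<forall>n. (i, j) \<in> R n"
    and bdryY: "\<And>j. spacelike_boundary_point Y dY j \<Longrightarrow> \<exists>i\<in>X. \<forall>n. (i, j) \<in> R n"
  shows "\<exists>f. lorentzian_isometry X dX Y dY f"
proof -
  obtain S where S: "admissible_topology X dX S"
    using bounded_lorentzian_metric_space.ex_admissible_topology[OF LX] by blast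
  obtain T where T: "admissible_topology Y dY T"
    using bounded_lorentzian_metric_space.ex_admissible_topology[OF LY] by blast
  have topS: "topspace S = X" and topT: "topspace T = Y"
    using S T unfolding admissible_topology_def by blast+
  have "\<forall>x\<in>X. \<exists>C u. compactin T C \<and> (\<forall>n. u n \<in> C) \<and> (\<forall>\<^sub>F n in sequentially. (x, u n) \<in> R n)"
    using eventually_partner_in_compact[OF LX T R dis e bdryX] by metis
  then obtain C u where C: "\<And>x. x \<in> X \<Longrightarrow> compactin T (C x)"
    and uC: "\<And>x n. x \<in> X \<Longrightarrow> u x n \<in> C x"
    and u: "\<And>x. x \<in> X \<Longrightarrow> \<forall>\<^sub>F n in sequentially. (x, u x n) \<in> R n"
    by metis
  have "\<exists>D v. compactin S D \<and> (\<forall>n. v n \<in> D) \<and> (\<forall>\<^sub>F n in sequentially. (v n, y) \<in> R n)"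
    if y: "y \<in> Y" for y
  proof -
    obtain D v where "compactin S D" "\<And>n. v n \<in> D"
      "\<forall>\<^sub>F n in sequentially. (y, v n) \<in> (R n)\<inverse>"
      using eventually_partner_in_compact[OF LY S correspondence_converse[OF R]
          distortion_at_most_converse[OF dis] e _ y] bdryY by auto
    then show ?thesis by auto
  qed
  then obtain D v where D: "\<And>y. y \<in> Y \<Longrightarrow> compactin S (D y)"
    and vD: "\<And>y n. y \<in> Y \<Longrightarrow> v y n \<in> D y"
    and v: "\<And>y. y \<in> Y \<Longrightarrow> \<forall>\<^sub>F n in sequentially. (v y n, y) \<in> R n"
    by metis
  \<comment> \<open>The spaces themselves may be non-compact; restricting each factor to its own compact set of
    candidates is what makes Tychonoff's theorem applicable.\<close>
  define P where "P = product_topology (\<lambda>x. subtopology T (C x)) X"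
  define Q where "Q = product_topology (\<lambda>y. subtopology S (D y)) Y"
  have compact: "compact_space (prod_topology P Q)"
    unfolding P_def Q_def using C D
    by (simp add: compact_space_prod_topology compact_space_product_topology
        compact_space_subtopology)
  have CY: "C x \<subseteq> Y" if "x \<in> X" for x
    using C[OF that] compactin_subset_topspace topT by blast
  have DX: "D y \<subseteq> X" if "y \<in> Y" for y
    using D[OF that] compactin_subset_topspace topS by blast
  define s where "s n = (\<lambda>x\<in>X. u x n, \<lambda>y\<in>Y. v y n)" for n
  have "(\<lambda>x\<in>X. u x n) \<in> topspace P" for n
    unfolding P_def using uC CY topT by auto
  moreover have "(\<lambda>y\<in>Y. v y n) \<in> topspace Q" for n
    unfolding Q_def using vD DX topS by auto
  ultimately have mem: "s n \<in> topspace (prod_topology P Q)" for n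
    by (simp add: s_def)
  obtain p where p: "p \<in> topspace (prod_topology P Q)"
    and lim: "\<And>h c. \<lbrakk>continuous_map (prod_topology P Q) euclideanreal h;
        (\<lambda>n. h (s n)) \<longlonglongrightarrow> c\<rbrakk> \<Longrightarrow> h p = c"
    using compact_space_cluster_point[where s = s, OF compact mem] by blast
  obtain f g where fg: "p = (f, g)"
    by (cases p)
  have f: "f x \<in> Y" if "x \<in> X" for x
    using p that topT unfolding fg P_def by (auto simp: PiE_iff)
  have g: "g y \<in> X" if "y \<in> Y" for y
    using p that topS unfolding fg Q_def by (auto simp: PiE_iff)
  have cont_fst: "continuous_map (prod_topology P Q) T (\<lambda>p. fst p x)" if "x \<in> X" for x
  proof -
    have "continuous_map P T (\<lambda>f. f x)"
      unfolding P_def using that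
      by (auto intro: continuous_map_into_fulltopology continuous_map_product_projection)
    from continuous_map_compose[OF continuous_map_fst this] show ?thesis
      by (simp add: o_def)
  qed
  have cont_snd: "continuous_map (prod_topology P Q) S (\<lambda>p. snd p y)" if "y \<in> Y" for y
  proof -
    have "continuous_map Q S (\<lambda>g. g y)"
      unfolding Q_def using that
      by (auto intro: continuous_map_into_fulltopology continuous_map_product_projection)
    from continuous_map_compose[OF continuous_map_snd this] show ?thesis
      by (simp add: o_def)
  qed
  have const: "continuous_map (prod_topology P Q) S (\<lambda>_. x)" if "x \<in> X" for x
    using that topS by simp
  have const': "continuous_map (prod_topology P Q) T (\<lambda>_. y)" if "y \<in> Y" for y
    using that topT by simp
  note cont = continuous_map_diff[OF continuous_map_admissible[OF S] continuous_map_admissible[OF T]]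
  note tends = distortion_tendsto_zero[OF dis e]
  have "lorentzian_isometry X dX Y dY f"
  proof (rule lorentzian_isometry_from_adjoint_maps[OF LX LY f g])
    fix x x' assume x: "x \<in> X" "x' \<in> X"
    have "dX x x' - dY (fst p x) (fst p x') = 0"
      by (rule lim[OF cont]) (use x const cont_fst tends[OF u u] in \<open>auto simp: s_def\<close>)
    then show "dX x x' = dY (f x) (f x')"
      by (simp add: fg)
  next
    fix y y' assume y: "y \<in> Y" "y' \<in> Y"
    have "dX (snd p y) (snd p y') - dY y y' = 0"
      by (rule lim[OF cont]) (use y const' cont_snd tends[OF v v] in \<open>auto simp: s_def\<close>)
    then show "dX (g y) (g y') = dY y y'"
      by (simp add: fg)
  next
    fix x y assume xy: "x \<in> X" "y \<in> Y"
    have "dX x (snd p y) - dY (fst p x) y = 0"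
      by (rule lim[OF cont]) (use xy const const' cont_fst cont_snd tends[OF u v] in \<open>auto simp: s_def\<close>)
    then show "dX x (g y) = dY (f x) y"
      by (simp add: fg)
    have "dX (snd p y) x - dY y (fst p x) = 0"
      by (rule lim[OF cont]) (use xy const const' cont_fst cont_snd tends[OF v u] in \<open>auto simp: s_def\<close>)
    then show "dX (g y) x = dY y (f x)"
      by (simp add: fg)
  qed
  then show ?thesis by blast
qed

lemma semidist_zero_imp_lorentzian_isometry:
  assumes LX: "bounded_lorentzian_metric_space X dX" and "X \<noteq> {}"
    and LY: "bounded_lorentzian_metric_space Y dY" and "Y \<noteq> {}"
    and bdry: "contains_spacelike_boundary X dX \<longleftrightarrow> contains_spacelike_boundary Y dY"
    and zero: "gromov_hausdorff_semidist X dX Y dY = 0"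
  shows "\<exists>f. lorentzian_isometry X dX Y dY f"
proof -
  define e :: "nat \<Rightarrow> real" where "e n = inverse (real (Suc n))" for n
  have "\<exists>R. correspondence X Y R \<and> distortion_at_most dX dY R (e n)" for n
    using gromov_hausdorff_semidist_less[OF assms(1-4), of "e n"] zero by (auto simp: e_def)
  then obtain R where R: "\<And>n. correspondence X Y (R n)"
    and dis: "\<And>n. distortion_at_most dX dY (R n) (e n)"
    by metis
  define S where
    "S = {(i, j). spacelike_boundary_point X dX i \<and> spacelike_boundary_point Y dY j}"
  have bdry': "(\<exists>i. spacelike_boundary_point X dX i) \<longleftrightarrow> (\<exists>j. spacelike_boundary_point Y dY j)"
    using bdry unfolding contains_spacelike_boundary_def spacelike_boundary_point_def by blast
  show ?thesis
  proof (rule lorentzian_isometry_from_small_distortion[OF LX LY, of "\<lambda>n. R n \<union> S"])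
    show "correspondence X Y (R n \<union> S)" and "distortion_at_most dX dY (R n \<union> S) (e n)" for n
      using correspondence_Un_boundary_points[OF R dis \<open>X \<noteq> {}\<close>] unfolding S_def by blast+
    show "e \<longlonglongrightarrow> 0"
      unfolding e_def by (rule LIMSEQ_inverse_real_of_nat)
    show "\<exists>j\<in>Y. \<forall>n. (i, j) \<in> R n \<union> S" if "spacelike_boundary_point X dX i" for i
      using that bdry' unfolding S_def by (auto simp: spacelike_boundary_point_def)
    show "\<exists>i\<in>X. \<forall>n. (i, j) \<in> R n \<union> S" if "spacelike_boundary_point Y dY j" for j
      using that bdry' unfolding S_def by (auto simp: spacelike_boundary_point_def)
  qed
qed

theorem theorem4p13:
  fixes X :: "'a set" and dX :: "'a \<Rightarrow> 'a \<Rightarrow> real"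
    and Y :: "'b set" and dY :: "'b \<Rightarrow> 'b \<Rightarrow> real"
    and Z :: "'c set" and dZ :: "'c \<Rightarrow> 'c \<Rightarrow> real"
  assumes "bounded_lorentzian_metric_space X dX" and "X \<noteq> {}"
    and "bounded_lorentzian_metric_space Y dY" and "Y \<noteq> {}"
    and "bounded_lorentzian_metric_space Z dZ" and "Z \<noteq> {}"
    and "(contains_spacelike_boundary X dX \<and> contains_spacelike_boundary Y dY \<and>
            contains_spacelike_boundary Z dZ) \<or>
         (\<not> contains_spacelike_boundary X dX \<and> \<not> contains_spacelike_boundary Y dY \<and>
            \<not> contains_spacelike_boundary Z dZ)"
  shows "gromov_hausdorff_semidist X dX Y dY \<ge> 0 \<and>
         (gromov_hausdorff_semidist X dX Y dY = 0 \<longleftrightarrow>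
           (\<exists>f. lorentzian_isometry X dX Y dY f)) \<and>
         (\<forall>f. lorentzian_isometry X dX Y dY f \<longrightarrow>
           homeomorphic_map (lorentzian_topology X dX) (lorentzian_topology Y dY) f) \<and>
         gromov_hausdorff_semidist X dX Y dY = gromov_hausdorff_semidist Y dY X dX \<and>
         gromov_hausdorff_semidist X dX Z dZ \<le>
           gromov_hausdorff_semidist X dX Y dY + gromov_hausdorff_semidist Y dY Z dZ"
proof (intro conjI)
  show "gromov_hausdorff_semidist X dX Y dY \<ge> 0"
    using assms by (intro gromov_hausdorff_semidist_nonneg)
  show "gromov_hausdorff_semidist X dX Y dY = 0 \<longleftrightarrow> (\<exists>f. lorentzian_isometry X dX Y dY f)"
    using lorentzian_isometry_imp_semidist_zero[OF assms(1-4)]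
      semidist_zero_imp_lorentzian_isometry[OF assms(1-4)] assms(7) by blast
  show "\<forall>f. lorentzian_isometry X dX Y dY f \<longrightarrow>
      homeomorphic_map (lorentzian_topology X dX) (lorentzian_topology Y dY) f"
    using homeomorphic_map_lorentzian_isometry by blast
  show "gromov_hausdorff_semidist X dX Y dY = gromov_hausdorff_semidist Y dY X dX"
    using assms(1-4) by (intro antisym gromov_hausdorff_semidist_sym_le)
  show "gromov_hausdorff_semidist X dX Z dZ \<le>
      gromov_hausdorff_semidist X dX Y dY + gromov_hausdorff_semidist Y dY Z dZ"
    by (rule gromov_hausdorff_semidist_triangle[OF assms(1-6)])
qed

end
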